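(* For every integer $n\geq 0$, the following three identities hold (as polynomial identities in the indeterminate $q$): \begin{align*} C_n&=\sum_{k=0}^{n}\frac{2k+1}{2n+1}\binom{2n+1}{n-k}\,\mathfrak{N}_k(q)\,(1-q)^{n-k},\\ q^{\frac{n}{2}+1}C_{\frac{n}{2}}&=\sum_{k=0}^{n}(-1)^{n-k}\binom{n}{k}\,\mathfrak{N}_{k+1}(q)\,(1+q)^{n-k},\\ q^{n+2}C_{n+1}&=\sum_{k=0}^{n}(-1)^{n-k}\binom{n}{k}\,\mathfrak{N}_{k+1}(q^2)\,(1-q)^{2(n-k)}, \end{align*} where in the second identity $C_{\frac n2}$ is interpreted as $0$ if $n$ is odd (so that the left-hand side is then $0$).
   Context: The Catalan numbers are $C_n=\frac{1}{n+1}\binom{2n}{n}$ for $n\ge 0$. The Narayana polynomials are $\mathfrak{N}_0(q)=1$ and, for $n\ge 1$, $\mathfrak{N}_n(q)=\sum_{k=1}^n\frac{1}{n}\binom{n}{k-1}\binom{n}{k}q^{k}$. *)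

theory Defs
  imports "HOL-Computational_Algebra.Polynomial"
begin

definition catalan :: "nat \<Rightarrow> rat" where
  "catalan n = 1 / of_nat (n + 1) * of_nat ((2 * n) choose n)"

abbreviation indet :: "rat poly" ("\<q>") where
  "\<q> \<equiv> [:0, 1:]"

definition narayana :: "nat \<Rightarrow> rat poly" where
  "narayana n =
    (if n = 0 then 1
     else (\<Sum>k = 1..n. smult (1 / of_nat n * of_nat (n choose (k - 1)) * of_nat (n choose k)) (\<q> ^ k)))"

text \<open>Catalan numbers at half-integers: \<open>catalan_half n\<close> stands for \<open>C\<^bsub>n/2\<^esub>\<close>, which is \<open>0\<close> for odd \<open>n\<close>.\<close>

definition catalan_half :: "nat \<Rightarrow> rat" where
  "catalan_half n = (if even n then catalan (n div 2) else 0)"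

end

theory Submission
  imports Defs
begin

text \<open>
  The second and third identities rest on the gamma expansion
  \<open>N\<^bsub>n+1\<^esub>(q) = \<Sum>k. (n choose k) q\<^bsup>k/2+1\<^esup> C\<^bsub>k/2\<^esub> (1 + q)\<^bsup>n-k\<^esup>\<close>,
  a Vandermonde convolution on coefficients. It says that the Narayana sequence is a binomial
  transform with parameter \<open>1 + q\<close>. Binomial transforms compose by adding their parameters, so
  the second identity is inversion. For the third, replacing \<open>q\<close> by \<open>q\<^sup>2\<close> leaves the transform with
  parameter \<open>(1 + q\<^sup>2) - (1 - q)\<^sup>2 = 2 q\<close>, which is evaluated by Touchard's identity, i.e. the
  gamma expansion at \<open>q = 1\<close>.

  For the first identity, expanding around \<open>q = 1\<close> gives
  \<open>N\<^sub>n(q) = \<Sum>k. ((n + k) choose (2 k)) C\<^sub>k (q - 1)\<^bsup>n-k\<^esup>\<close> (again Vandermonde), and the matrix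
  of signed binomials \<open>(-1)\<^bsup>k+j\<^esup> ((k + j) choose (2 j))\<close> is inverse to that of the ballot numbers
  \<open>(2 k + 1) / (2 n + 1) ((2 n + 1) choose (n - k))\<close>.
\<close>

section \<open>Binomial transforms and their composition\<close>

text \<open>Umbrally this is \<open>(x + a) ^ n\<close> with \<open>a ^ k\<close> read as
  \<open>a k\<close>. It is applied over polynomials and, in \<open>touchard\<close>, over the
  rationals.\<close>

definition binom_trans :: "'a::comm_ring_1 \<Rightarrow> (nat \<Rightarrow> 'a) \<Rightarrow> nat \<Rightarrow> 'a" where
  "binom_trans x a n = (\<Sum>k\<le>n. of_nat (n choose k) * x ^ (n - k) * a k)"

text \<open>Pascal's rule, with the shift of the sequence in the role of multiplication by the
  umbra. It allows inductions on \<open>n\<close> that avoid double sums.\<close>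

lemma binom_trans_Suc:
  "binom_trans x a (Suc n) = x * binom_trans x a n + binom_trans x (\<lambda>k. a (Suc k)) n"
proof -
  have "binom_trans x a (Suc n) = x ^ Suc n * a 0
      + (\<Sum>k\<le>n. of_nat (n choose k) * x ^ (n - k) * a (Suc k))
      + (\<Sum>k\<le>n. of_nat (n choose Suc k) * x ^ (n - k) * a (Suc k))"
    unfolding binom_trans_def sum.atMost_Suc_shift
    by (simp add: sum.distrib ring_distribs del: sum.atMost_Suc)
  \<comment> \<open>The added term \<open>k = Suc n\<close> is 0; splitting off \<open>k = 0\<close>
    then yields the sum with \<open>n choose Suc k\<close>.\<close>
  moreover have "x * binom_trans x a n = (\<Sum>k\<le>Suc n. of_nat (n choose k) * x ^ (Suc n - k) * a k)"
    by (simp add: binom_trans_def sum_distrib_left Suc_diff_le binomial_eq_0 mult_ac)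
  ultimately show ?thesis
    by (simp add: sum.atMost_Suc_shift binom_trans_def del: sum.atMost_Suc)
qed

lemma binom_trans_add: "binom_trans x (\<lambda>k. a k + b k) n = binom_trans x a n + binom_trans x b n"
  by (simp add: binom_trans_def ring_distribs sum.distrib)

lemma binom_trans_cmult: "binom_trans x (\<lambda>k. c * a k) n = c * binom_trans x a n"
  by (simp add: binom_trans_def sum_distrib_left mult_ac)

text \<open>Both sides obey the recursion \<open>binom_trans_Suc\<close>. Since it shifts the
  sequence, the induction hypothesis must cover every \<open>a\<close>.\<close>

lemma binom_trans_binom_trans: "binom_trans x (binom_trans y a) n = binom_trans (x + y) a n"
proof (induction n arbitrary: a)
  case 0
  then show ?case by (simp add: binom_trans_def)
next
  case (Suc n)
  then show ?case
    by (simp add: binom_trans_Suc[of x] binom_trans_Suc[of y] binom_trans_Suc[of "x + y"]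
        binom_trans_add binom_trans_cmult ring_distribs)
qed

lemma binom_trans_0: "binom_trans 0 a n = a n"
  by (induction n arbitrary: a) (simp_all add: binom_trans_Suc, simp add: binom_trans_def)

section \<open>Composition, coefficients and sums over even indices\<close>

lemma pcompose_power: "pcompose (p ^ n) r = pcompose p r ^ n"
  for p r :: "'a::comm_semiring_1 poly"
  by (induction n) (simp_all add: pcompose_mult pcompose_1)

lemma binom_trans_pcompose:
  "binom_trans x a n \<circ>\<^sub>p r = binom_trans (x \<circ>\<^sub>p r) (\<lambda>k. a k \<circ>\<^sub>p r) n"
  by (simp add: binom_trans_def pcompose_sum pcompose_mult pcompose_power pcompose_smult of_nat_poly)

lemma smult_sum_right: "smult c (\<Sum>i\<in>A. f i) = (\<Sum>i\<in>A. smult c (f i))"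
  by (induction A rule: infinite_finite_induct) (simp_all add: smult_add_right)

lemma coeff_one_plus_power: "coeff ((1 + \<q>) ^ m) i = of_nat (m choose i)"
  by (induction m arbitrary: i)
    (auto simp: one_pCons coeff_pCons algebra_simps split: nat.splits)

lemma coeff_indet_power_mult: "coeff (\<q> ^ k * p) i = (if i < k then 0 else coeff p (i - k))"
  using coeff_monom_mult[of 1 k p i] by (simp add: monom_altdef)

lemma coeff_indet_power: "coeff (\<q> ^ k) i = (if i = k then 1 else 0)"
  using coeff_monom[of "1::rat" k i] by (simp add: monom_altdef eq_commute)

lemma sum_atMost_even:
  fixes f :: "nat \<Rightarrow> 'a::comm_monoid_add"
  assumes "\<And>k. odd k \<Longrightarrow> f k = 0"
  shows "(\<Sum>k\<le>n. f k) = (\<Sum>j\<le>n div 2. f (2 * j))"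
proof -
  have "(\<Sum>k\<le>n. f k) = (\<Sum>k\<in>(*) 2 ` {..n div 2}. f k)"
  proof (rule sum.mono_neutral_right)
    show "\<forall>k\<in>{..n} - (*) 2 ` {..n div 2}. f k = 0"
    proof
      fix k assume "k \<in> {..n} - (*) 2 ` {..n div 2}"
      then have "odd k" by (auto elim!: evenE)
      then show "f k = 0" by (rule assms)
    qed
  qed auto
  then show ?thesis by (simp add: sum.reindex inj_on_def)
qed

section \<open>Narayana coefficients and the gamma expansion\<close>

lemma coeff_narayana_Suc_0: "coeff (narayana (Suc n)) 0 = 0"
  by (simp add: narayana_def coeff_sum power_eq_if)

lemma coeff_narayana_Suc_Suc:
  "coeff (narayana (Suc n)) (Suc r) =
    of_nat (Suc n choose r) * of_nat (Suc n choose Suc r) / of_nat (Suc n)"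
proof -
  have "coeff (narayana (Suc n)) (Suc r) =
      (\<Sum>k = 1..Suc n. if k = Suc r then
         of_nat (Suc n choose r) * of_nat (Suc n choose Suc r) / of_nat (Suc n) else 0)"
    unfolding narayana_def
    by (simp only: coeff_sum coeff_smult coeff_indet_power nat.distinct if_False, intro sum.cong refl)
      (simp del: binomial_Suc_Suc of_nat_Suc)
  also have "\<dots> = of_nat (Suc n choose r) * of_nat (Suc n choose Suc r) / of_nat (Suc n)"
    by (cases "r \<le> n") (auto simp: binomial_eq_0)
  finally show ?thesis .
qed

lemma catalan_fact: "catalan n = fact (2 * n) / (fact n * fact (Suc n))"
  by (simp add: catalan_def binomial_fact mult_2)

text \<open>The left-hand side of the second identity as a sequence. For odd \<open>k\<close> the
  scalar is 0, so the rounding in \<open>k div 2\<close> is harmless.\<close>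

definition aerated_catalan :: "nat \<Rightarrow> rat poly" where
  "aerated_catalan k = smult (catalan_half k) (\<q> ^ (k div 2 + 1))"

text \<open>Both sides equal \<open>(2 j + s + t)! / (j! (j + 1)! s! t!)\<close>. With
  \<open>r = j + s\<close> and \<open>n = 2 j + s + t\<close>, the first factor on the right depends
  only on \<open>n\<close> and \<open>r\<close>, and the rest is a Vandermonde summand.\<close>

lemma gamma_term:
  "of_nat ((2 * j + s + t) choose (2 * j)) * catalan j * of_nat ((s + t) choose s) =
    of_nat (Suc (2 * j + s + t) choose (j + s)) / of_nat (Suc (2 * j + s + t)) *
    of_nat (((j + s) choose j) * (Suc (j + t) choose t))"
proof -
  have a: "of_nat ((2 * j + s + t) choose (2 * j)) = (fact (2 * j + s + t) / (fact (2 * j) * fact (s + t)) :: rat)"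
    by (simp add: binomial_fact)
  have b: "of_nat ((s + t) choose s) = (fact (s + t) / (fact s * fact t) :: rat)"
    by (simp add: binomial_fact)
  have "Suc (2 * j + s + t) - (j + s) = Suc (j + t)" by simp
  then have c: "of_nat (Suc (2 * j + s + t) choose (j + s)) =
      (fact (Suc (2 * j + s + t)) / (fact (j + s) * fact (Suc (j + t))) :: rat)"
    by (subst binomial_fact) (simp_all del: fact_Suc)
  have d: "of_nat ((j + s) choose j) = (fact (j + s) / (fact j * fact s) :: rat)"
    by (simp add: binomial_fact)
  have e: "of_nat (Suc (j + t) choose t) = (fact (Suc (j + t)) / (fact t * fact (Suc j)) :: rat)"
    by (subst binomial_fact) (simp_all add: Suc_diff_le del: fact_Suc)
  have f: "fact (Suc (2 * j + s + t)) = (of_nat (Suc (2 * j + s + t)) * fact (2 * j + s + t) :: rat)"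
    by simp
  show ?thesis
    unfolding of_nat_mult a b c d e f catalan_fact
    by (simp del: fact_Suc of_nat_Suc)
qed

lemma gamma_coeff_sum:
  "(\<Sum>j\<le>n div 2. of_nat (n choose (2 * j)) * catalan j *
      (if r < j then 0 else of_nat ((n - 2 * j) choose (r - j)))) =
    of_nat (Suc n choose r) * of_nat (Suc n choose Suc r) / of_nat (Suc n)"
proof (cases "r \<le> n")
  case True
  define f where "f j = of_nat (Suc n choose r) / of_nat (Suc n) *
    (of_nat ((r choose j) * ((Suc n - r) choose (n - r - j))) :: rat)" for j
  define g where "g j = of_nat (n choose (2 * j)) * catalan j *
      (if r < j then 0 else of_nat ((n - 2 * j) choose (r - j)))" for j
  have fg: "g j = f j" if j: "j \<le> r" "j \<le> n - r" for j
  proof -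
    obtain s where s: "r = j + s" using le_Suc_ex[OF j(1)] ..
    have le: "r + j \<le> n" using j True by simp
    obtain t where "n = r + j + t" using le_Suc_ex[OF le] ..
    then have n: "n = 2 * j + s + t" using s by simp
    have h: "n - 2 * j = s + t" "r - j = s" "Suc n - r = Suc (j + t)" "n - r - j = t"
      using n s by auto
    have "\<not> r < j" using j by simp
    then show ?thesis unfolding g_def f_def h if_not_P unfolding n s by (simp only: gamma_term if_False)
  qed
  \<comment> \<open>Past \<open>r\<close> the conditional makes \<open>g\<close> vanish; past
    \<open>n - r\<close> the binomial does, because then \<open>r - j > n - 2 * j\<close>.\<close>
  have "(\<Sum>j\<le>n div 2. g j) = (\<Sum>j\<le>min r (n - r). g j)"
    by (rule sum.mono_neutral_right) (use True in \<open>auto simp: g_def not_le\<close>)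
  also have "\<dots> = (\<Sum>j\<le>min r (n - r). f j)"
    by (rule sum.cong) (auto simp: fg)
  \<comment> \<open>For \<open>j > r\<close> the factor \<open>r choose j\<close> is 0, so the range
    extends to that of Vandermonde's convolution.\<close>
  also have "\<dots> = (\<Sum>j\<le>n - r. f j)"
    by (rule sum.mono_neutral_left) (auto simp: f_def)
  also have "\<dots> = of_nat (Suc n choose r) / of_nat (Suc n) * of_nat ((r + (Suc n - r)) choose (n - r))"
    unfolding f_def sum_distrib_left[symmetric] of_nat_sum[symmetric] vandermonde ..
  also have "(r + (Suc n - r)) choose (n - r) = Suc n choose Suc r"
    using True binomial_symmetric[of "Suc r" "Suc n"] by simp
  finally show ?thesis unfolding g_def by simp
next
  case False
  have "(\<Sum>j\<le>n div 2. of_nat (n choose (2 * j)) * catalan j *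
      (if r < j then 0 else of_nat ((n - 2 * j) choose (r - j)))) = 0"
    by (rule sum.neutral) (use False in auto)
  with False show ?thesis by (simp add: binomial_eq_0)
qed

text \<open>Coefficients are compared: odd \<open>k\<close> drop out, and since every term carries a
  factor q, the coefficient at \<open>Suc r\<close> is \<open>gamma_coeff_sum\<close>.\<close>

lemma narayana_gamma: "narayana (Suc n) = binom_trans (1 + \<q>) aerated_catalan n"
proof (rule poly_eqI)
  fix i
  have c: "coeff (of_nat (n choose k) * (1 + \<q>) ^ (n - k) * aerated_catalan k) i =
      (if i < k div 2 + 1 then 0
       else of_nat (n choose k) * catalan_half k * of_nat ((n - k) choose (i - (k div 2 + 1))))" for k
  proof -
    have "of_nat (n choose k) * (1 + \<q>) ^ (n - k) * aerated_catalan k =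
        smult (of_nat (n choose k) * catalan_half k) (\<q> ^ (k div 2 + 1) * (1 + \<q>) ^ (n - k))"
      by (simp add: aerated_catalan_def of_nat_poly mult_ac)
    then show ?thesis
      by (simp only: coeff_smult coeff_indet_power_mult coeff_one_plus_power) simp
  qed
  have "coeff (binom_trans (1 + \<q>) aerated_catalan n) i =
      (\<Sum>j\<le>n div 2. if i < j + 1 then 0
       else of_nat (n choose (2 * j)) * catalan j * of_nat ((n - 2 * j) choose (i - (j + 1))))"
    unfolding binom_trans_def coeff_sum c
    by (subst sum_atMost_even) (auto simp: catalan_half_def intro!: sum.cong)
  also have "\<dots> = coeff (narayana (Suc n)) i"
  proof (cases i)
    case 0
    then show ?thesis by (simp add: coeff_narayana_Suc_0)
  next
    case (Suc r)
    then show ?thesis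
      by (simp add: coeff_narayana_Suc_Suc gamma_coeff_sum[symmetric] if_distrib cong: if_cong
          del: binomial_Suc_Suc of_nat_Suc)
  qed
  finally show "coeff (narayana (Suc n)) i = coeff (binom_trans (1 + \<q>) aerated_catalan n) i" ..
qed

section \<open>Touchard's identity and the third identity\<close>

text \<open>Replacing \<open>Suc n choose Suc r\<close> by \<open>Suc n choose (n - r)\<close> turns
  the sum into a Vandermonde convolution.\<close>

lemma poly_narayana_1: "poly (narayana (Suc n)) 1 = catalan (Suc n)"
proof -
  have "poly (narayana (Suc n)) 1 =
      (\<Sum>r\<le>n. of_nat (Suc n choose r) * of_nat (Suc n choose Suc r)) / of_nat (Suc n)"
    unfolding narayana_def
    by (simp add: poly_sum sum_divide_distrib sum.atLeast_Suc_atMost_Suc_shift atLeast0AtMost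
        del: sum.cl_ivl_Suc)
  also have "(\<Sum>r\<le>n. of_nat (Suc n choose r) * of_nat (Suc n choose Suc r) :: rat) =
      of_nat (\<Sum>r\<le>n. (Suc n choose r) * (Suc n choose (n - r)))"
    unfolding of_nat_sum
    using binomial_symmetric[of "Suc _" "Suc n"] by (intro sum.cong) auto
  also have "\<dots> = of_nat ((2 * Suc n) choose n)"
    by (simp only: vandermonde mult_2)
  also have "\<dots> / of_nat (Suc n) = catalan (Suc n)"
    unfolding catalan_fact
    by (subst binomial_fact) (simp_all add: field_simps)
  finally show ?thesis .
qed

lemma touchard: "binom_trans 2 catalan_half n = catalan (Suc n)"
  unfolding poly_narayana_1[symmetric] narayana_gamma
  by (simp add: binom_trans_def poly_sum aerated_catalan_def mult_ac)

text \<open>Adding the parameters leaves the transform with parameter 2 q, in which every nonzero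
  term is a multiple of the same power of q; Touchard's identity sums the scalars.\<close>

lemma narayana_square_transform:
  "binom_trans (- ((1 - \<q>) ^ 2)) (\<lambda>k. narayana (Suc k) \<circ>\<^sub>p \<q>\<^sup>2) n =
    smult (catalan (Suc n)) (\<q> ^ (n + 2))"
proof -
  have "(\<lambda>k. narayana (Suc k) \<circ>\<^sub>p \<q>\<^sup>2) =
      binom_trans (1 + \<q>\<^sup>2) (\<lambda>k. aerated_catalan k \<circ>\<^sub>p \<q>\<^sup>2)"
    by (rule ext) (simp add: narayana_gamma binom_trans_pcompose pcompose_add pcompose_1 pcompose_pCons)
  then have "binom_trans (- ((1 - \<q>) ^ 2)) (\<lambda>k. narayana (Suc k) \<circ>\<^sub>p \<q>\<^sup>2) n =
      binom_trans (- ((1 - \<q>) ^ 2) + (1 + \<q>\<^sup>2)) (\<lambda>k. aerated_catalan k \<circ>\<^sub>p \<q>\<^sup>2) n"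
    by (simp only: binom_trans_binom_trans)
  also have "- ((1 - \<q>) ^ 2) + (1 + \<q>\<^sup>2) = 2 * \<q>"
    by (simp add: power2_eq_square ring_distribs)
  also have "binom_trans (2 * \<q>) (\<lambda>k. aerated_catalan k \<circ>\<^sub>p \<q>\<^sup>2) n =
      (\<Sum>k\<le>n. smult (of_nat (n choose k) * 2 ^ (n - k) * catalan_half k) (\<q> ^ (n + 2)))"
    unfolding binom_trans_def
  proof (rule sum.cong[OF refl])
    fix k assume "k \<in> {..n}"
    then have k: "k \<le> n" by simp
    show "of_nat (n choose k) * (2 * \<q>) ^ (n - k) * (aerated_catalan k \<circ>\<^sub>p \<q>\<^sup>2) =
      smult (of_nat (n choose k) * 2 ^ (n - k) * catalan_half k) (\<q> ^ (n + 2))"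
    proof (cases "even k")
      case True
      \<comment> \<open>The exponent \<open>n - k\<close> from the parameter and
        \<open>k + 2\<close> from the squared variable add up independently of
        \<open>k\<close>.\<close>
      then have "n - k + 2 * (k div 2 + 1) = n + 2" using k by auto
      then have "\<q> ^ (n - k) * (\<q>\<^sup>2) ^ (k div 2 + 1) = \<q> ^ (n + 2)"
        by (metis power_add power_mult)
      moreover have "aerated_catalan k \<circ>\<^sub>p \<q>\<^sup>2 = smult (catalan_half k) ((\<q>\<^sup>2) ^ (k div 2 + 1))"
        by (simp only: aerated_catalan_def pcompose_smult pcompose_power) (simp add: pcompose_pCons)
      moreover have "(2 * \<q>) ^ (n - k) = smult (2 ^ (n - k)) (\<q> ^ (n - k))"
        
      proof -
        have "2 * \<q> = smult 2 \<q>" by (simp add: numeral_poly)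
        then show ?thesis by (simp only: smult_power)
      qed
      ultimately show ?thesis
        by (simp add: of_nat_poly mult_ac)
    next
      case False
      then show ?thesis by (simp add: aerated_catalan_def catalan_half_def)
    qed
  qed
  also have "\<dots> = smult (binom_trans 2 catalan_half n) (\<q> ^ (n + 2))"
    unfolding binom_trans_def smult_sum ..
  finally show ?thesis by (simp only: touchard)
qed

section \<open>Ballot numbers and the inverse of their matrix\<close>

text \<open>The reflection-principle count of nonnegative paths with \<open>2 * n\<close> unit steps
  from 0 to \<open>2 * k\<close>. As a difference of binomials it inherits its recursion from
  Pascal's rule.\<close>

definition ballot :: "nat \<Rightarrow> nat \<Rightarrow> rat" where
  "ballot n k = of_nat (2 * n choose (n + k)) - of_nat (2 * n choose (n + Suc k))"

lemma ballot_eq_0: "n < k \<Longrightarrow> ballot n k = 0"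
  by (simp add: ballot_def binomial_eq_0)

lemma ballot_Suc_Suc: "ballot (Suc n) (Suc k) = ballot n k + 2 * ballot n (Suc k) + ballot n (Suc (Suc k))"
  by (simp add: ballot_def)

text \<open>At the boundary Pascal's rule produces \<open>2 * n choose (n - 1)\<close>, which
  symmetry identifies with \<open>2 * n choose Suc n\<close>.\<close>

lemma ballot_Suc_0: "ballot (Suc n) 0 = ballot n 0 + ballot n (Suc 0)"
proof (cases n)
  case (Suc m)
  have "2 * n choose m = 2 * n choose (Suc n)"
    using binomial_symmetric[of m "2 * n"] Suc by simp
  then show ?thesis by (simp add: ballot_def Suc)
qed (simp add: ballot_def numeral_2_eq_2)

text \<open>Over the common denominator \<open>(n - k)! (n + k + 1)!\<close> the difference has
  numerator \<open>(2 n)!\<close> times \<open>(n + k + 1) - (n - k) = 2 k + 1\<close>.\<close>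

lemma ballot_altdef:
  assumes "k \<le> n"
  shows "of_nat (2 * k + 1) / of_nat (2 * n + 1) * of_nat ((2 * n + 1) choose (n - k)) = ballot n k"
proof (cases "k = n")
  case True
  then show ?thesis by (simp add: ballot_def flip: mult_2)
next
  case False
  then obtain m where m: "n = Suc (k + m)" using assms by (metis less_natE le_neq_implies_less)
  have 1: "(of_nat ((2 * n + 1) choose (n - k)) :: rat) =
      of_nat (2 * n + 1) * fact (2 * n) / (fact (Suc m) * (of_nat (n + k + 1) * fact (n + k)))"
    
  proof -
    have "2 * n + 1 - (n - k) = Suc (n + k)" using assms by simp
    moreover have "n - k = Suc m" by (simp add: m)
    moreover have "fact (2 * n + 1) = (of_nat (2 * n + 1) * fact (2 * n) :: rat)" by simp
    moreover have "fact (Suc (n + k)) = (of_nat (n + k + 1) * fact (n + k) :: rat)" by simp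
    moreover have "n - k \<le> 2 * n + 1" by simp
    ultimately show ?thesis by (simp only: binomial_fact)
  qed
  have 2: "(of_nat (2 * n choose (n + k)) :: rat) = fact (2 * n) / (fact (n + k) * fact (Suc m))"
    by (subst binomial_fact) (simp_all add: m del: fact_Suc)
  have 3: "(of_nat (2 * n choose (n + Suc k)) :: rat) =
      fact (2 * n) / (of_nat (n + k + 1) * fact (n + k) * fact m)"
    by (subst binomial_fact) (simp_all add: m)
  have 4: "fact (Suc m) = (of_nat (Suc m) * fact m :: rat)" by simp
  have 5: "(of_nat (2 * k + 1) :: rat) = of_nat (n + k + 1) - of_nat (Suc m)" by (simp add: m)
  \<comment> \<open>With factorials and casts opaque, a field identity remains, in which
    \<open>A - B\<close> stands for \<open>2 * k + 1\<close>.\<close>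
  define F G H :: rat where "F = fact (2 * n)" and "G = fact (n + k)" and "H = fact m"
  define A B D :: rat where "A = of_nat (n + k + 1)" and "B = of_nat (Suc m)" and "D = of_nat (2 * n + 1)"
  have nz: "G \<noteq> 0" "H \<noteq> 0" "A \<noteq> 0" "B \<noteq> 0" "D \<noteq> 0"
    unfolding F_def G_def H_def A_def B_def D_def by (simp_all del: of_nat_Suc of_nat_add)
  show ?thesis
    unfolding ballot_def 1 2 3 4 5 F_def[symmetric] G_def[symmetric] H_def[symmetric]
      A_def[symmetric] B_def[symmetric] D_def[symmetric]
    using nz by (simp add: field_simps)
qed

text \<open>Summation by parts: the recursion of \<open>ballot\<close> in \<open>n\<close> is moved
  onto \<open>f\<close>, which gives the induction step of \<open>ballot_inverse\<close>.\<close>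

lemma sum_ballot_Suc:
  "(\<Sum>k\<le>Suc n. ballot (Suc n) k * f k) =
    ballot n 0 * (f 0 + f 1) + (\<Sum>k<n. ballot n (Suc k) * (f k + 2 * f (Suc k) + f (Suc (Suc k))))"
proof -
  have 1: "(\<Sum>k\<le>n. ballot n k * f (Suc k)) = ballot n 0 * f 1 + (\<Sum>k<n. ballot n (Suc k) * f (Suc (Suc k)))"
    by (simp flip: lessThan_Suc_atMost add: sum.lessThan_Suc_shift del: sum.lessThan_Suc)
  have 2: "(\<Sum>k\<le>n. ballot n (Suc k) * f (Suc k)) = (\<Sum>k<n. ballot n (Suc k) * f (Suc k))"
    by (simp flip: lessThan_Suc_atMost add: ballot_eq_0)
  have "(\<Sum>k\<le>n. ballot n (Suc (Suc k)) * f (Suc k)) = (\<Sum>k<n. ballot n (Suc (Suc k)) * f (Suc k))"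
    by (simp flip: lessThan_Suc_atMost add: ballot_eq_0)
  moreover have "(\<Sum>k<n. ballot n (Suc k) * f k) =
      ballot n (Suc 0) * f 0 + (\<Sum>k<n. ballot n (Suc (Suc k)) * f (Suc k))"
    using sum.lessThan_Suc_shift[of "\<lambda>k. ballot n (Suc k) * f k" n] by (simp add: ballot_eq_0)
  ultimately have 3: "(\<Sum>k\<le>n. ballot n (Suc (Suc k)) * f (Suc k)) =
      (\<Sum>k<n. ballot n (Suc k) * f k) - ballot n (Suc 0) * f 0" by simp
  have "(\<Sum>k\<le>Suc n. ballot (Suc n) k * f k) = ballot (Suc n) 0 * f 0 +
      (\<Sum>k\<le>n. ballot n k * f (Suc k)) + 2 * (\<Sum>k\<le>n. ballot n (Suc k) * f (Suc k)) +
      (\<Sum>k\<le>n. ballot n (Suc (Suc k)) * f (Suc k))"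
    by (simp add: sum.atMost_Suc_shift ballot_Suc_Suc ring_distribs sum.distrib sum_distrib_left mult.assoc
        del: sum.atMost_Suc)
  then show ?thesis
    unfolding 1 2 3 ballot_Suc_0
    by (simp add: ring_distribs sum.distrib sum_distrib_left mult_ac)
qed

text \<open>Up to sign, the combination in \<open>sum_ballot_Suc\<close> is a second difference of
  binomials. It lowers \<open>2 * j\<close> by 2, so \<open>j\<close> and \<open>n\<close> descend
  together.\<close>

lemma ballot_inverse:
  "(\<Sum>k\<le>n. ballot n k * ((-1) ^ (k + j) * of_nat ((k + j) choose (2 * j)))) = (if j = n then 1 else 0)"
proof (induction n arbitrary: j)
  case 0
  then show ?case by (simp add: ballot_def)
next
  case (Suc n)
  define f :: "nat \<Rightarrow> rat" where "f k = (-1) ^ (k + j) * of_nat ((k + j) choose (2 * j))" for k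
  show ?case
  proof (cases j)
    case 0
    \<comment> \<open>Here \<open>f\<close> is the alternating sign, which both combinations
      annihilate.\<close>
    then show ?thesis unfolding f_def[symmetric] sum_ballot_Suc by (simp add: f_def)
  next
    case (Suc i)
    define g :: "nat \<Rightarrow> rat" where "g k = (-1) ^ (k + i) * of_nat ((k + i) choose (2 * i))" for k
    have g0: "f 0 + f 1 = g 0"
      by (cases i) (simp_all add: f_def g_def Suc binomial_eq_0 numeral_2_eq_2)
    have gS: "f k + 2 * f (Suc k) + f (Suc (Suc k)) = g (Suc k)" for k
      by (simp add: f_def g_def Suc algebra_simps)
    have "(\<Sum>k\<le>Suc n. ballot (Suc n) k * f k) = (\<Sum>k\<le>n. ballot n k * g k)"
      unfolding sum_ballot_Suc g0 gS
      by (simp flip: lessThan_Suc_atMost add: sum.lessThan_Suc_shift del: sum.lessThan_Suc)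
    also have "\<dots> = (if i = n then 1 else 0)"
      unfolding g_def by (rule Suc.IH)
    finally show ?thesis unfolding f_def Suc by simp
  qed
qed

section \<open>Expansion of the Narayana polynomials around q = 1\<close>

text \<open>The coefficient of the \<open>m\<close>-th power of q - 1. Extracting
  \<open>n choose m\<close> from \<open>(n choose r) * (r choose m)\<close> leaves a Vandermonde
  sum.\<close>

lemma narayana_shift_coeff:
  assumes "n > 0" "m \<le> n"
  shows "(\<Sum>r = 1..n. 1 / of_nat n * of_nat (n choose (r - 1)) * of_nat (n choose r) * of_nat (r choose m)) =
    of_nat ((2 * n - m) choose m) * catalan (n - m)"
proof -
  obtain l where n: "n = m + l" using assms le_Suc_ex by blast
  obtain n' where n': "n = Suc n'" using assms by (cases n) auto
  have "(\<Sum>r = 1..n. (n choose (r - 1)) * (n choose r) * (r choose m)) =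
      (\<Sum>i\<le>n'. (n choose i) * ((n choose m) * (l choose (n' - i))))"
  proof -
    \<comment> \<open>Nested subsets are chosen in either order, then complemented in the remaining
      \<open>l = n - m\<close> elements; for \<open>Suc i < m\<close> both sides are 0.\<close>
    have "(n choose Suc i) * (Suc i choose m) = (n choose m) * (l choose (n' - i))" if "i \<le> n'" for i
    proof (cases "m \<le> Suc i")
      case True
      have "l choose (Suc i - m) = l choose (l - (Suc i - m))"
        using that n n' by (intro binomial_symmetric) auto
      also have "l - (Suc i - m) = n' - i" using True n n' that by simp
      finally show ?thesis using choose_mult[of m "Suc i" n] True that n n' by simp
    next
      case False
      then show ?thesis using that n n' by (simp add: binomial_eq_0)
    qed
    then show ?thesis unfolding n'
      by (simp add: sum.atLeast_Suc_atMost_Suc_shift atLeast0AtMost mult.assoc del: sum.cl_ivl_Suc binomial_Suc_Suc)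
  qed
  also have "\<dots> = (n choose m) * ((n + l) choose n')"
    by (simp add: vandermonde[symmetric] sum_distrib_left mult_ac)
  finally have *: "(\<Sum>r = 1..n. (n choose (r - 1)) * (n choose r) * (r choose m)) =
      (n choose m) * ((n + l) choose n')" .
  have "(\<Sum>r = 1..n. 1 / of_nat n * of_nat (n choose (r - 1)) * of_nat (n choose r) * of_nat (r choose m)) =
      (1 / of_nat n :: rat) * of_nat (\<Sum>r = 1..n. (n choose (r - 1)) * (n choose r) * (r choose m))"
    by (simp add: sum_distrib_left mult_ac)
  also have "\<dots> = 1 / of_nat n * of_nat (n choose m) * of_nat ((n + l) choose n')"
    unfolding * by simp
  also have "of_nat (n choose m) = (of_nat n * fact n' / (fact m * fact l) :: rat)"
    
  proof -
    have "n - m = l" using n by simp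
    moreover have "fact n = (of_nat n * fact n' :: rat)" by (simp add: n')
    ultimately show ?thesis by (simp only: binomial_fact[OF assms(2)])
  qed
  also have "of_nat ((n + l) choose n') = (fact (n + l) / (fact n' * fact (Suc l)) :: rat)"
    using n' by (subst binomial_fact) (simp_all del: fact_Suc add: Suc_diff_le)
  also have "1 / of_nat n * (of_nat n * fact n' / (fact m * fact l)) * (fact (n + l) / (fact n' * fact (Suc l)))
      = fact (n + l) / (fact m * fact l * fact (Suc l) :: rat)"
    using assms by (simp del: fact_Suc)
  also have "\<dots> = of_nat ((2 * n - m) choose m) * (fact (2 * l) / (fact l * fact (Suc l)))"
  proof -
    have "2 * n - m = n + l" "n + l - m = 2 * l" "m \<le> n + l" using n by auto
    then show ?thesis by (simp add: binomial_fact del: fact_Suc)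
  qed
  also have "fact (2 * l) / (fact l * fact (Suc l)) = catalan (n - m)"
    using n by (simp add: catalan_def binomial_fact mult_2)
  finally show ?thesis .
qed

text \<open>Each power of q is expanded in powers of q - 1 and the sums are swapped; finally
  \<open>k = n - m\<close> gives \<open>2 * n - m = n + k\<close>, and symmetry gives the lower
  index \<open>2 * k\<close>.\<close>

lemma narayana_shift:
  "narayana n = (\<Sum>k\<le>n. smult (of_nat ((n + k) choose (2 * k)) * catalan k) ((\<q> - 1) ^ (n - k)))"
proof (cases "n = 0")
  case True
  then show ?thesis by (simp add: narayana_def catalan_def)
next
  case False
  have q: "\<q> ^ r = (\<Sum>m\<le>n. smult (of_nat (r choose m)) ((\<q> - 1) ^ m))" if "r \<le> n" for r
  proof -
    have "\<q> ^ r = ((\<q> - 1) + 1) ^ r" by simp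
    also have "\<dots> = (\<Sum>m\<le>r. smult (of_nat (r choose m)) ((\<q> - 1) ^ m))"
      unfolding binomial_ring by (simp add: of_nat_poly)
    also have "\<dots> = (\<Sum>m\<le>n. smult (of_nat (r choose m)) ((\<q> - 1) ^ m))"
      by (rule sum.mono_neutral_left) (use that in auto)
    finally show ?thesis .
  qed
  define c :: "nat \<Rightarrow> rat" where
    "c r = 1 / of_nat n * of_nat (n choose (r - 1)) * of_nat (n choose r)" for r
  have "narayana n = (\<Sum>r = 1..n. \<Sum>m\<le>n. smult (c r * of_nat (r choose m)) ((\<q> - 1) ^ m))"
    using False unfolding narayana_def c_def[symmetric] by (simp add: q smult_sum_right)
  also have "\<dots> = (\<Sum>m\<le>n. smult (\<Sum>r = 1..n. c r * of_nat (r choose m)) ((\<q> - 1) ^ m))"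
    by (subst sum.swap) (simp add: smult_sum)
  also have "\<dots> = (\<Sum>m\<le>n. smult (of_nat ((2 * n - m) choose m) * catalan (n - m)) ((\<q> - 1) ^ m))"
    using False by (intro sum.cong refl arg_cong2[of _ _ _ _ smult])
      (simp only: c_def narayana_shift_coeff atMost_iff neq0_conv)
  also have "\<dots> = (\<Sum>k\<le>n. smult (of_nat ((n + k) choose (n - k)) * catalan k) ((\<q> - 1) ^ (n - k)))"
    by (rule sum.reindex_bij_witness[of _ "\<lambda>k. n - k" "\<lambda>k. n - k"]) (auto simp: mult_2)
  also have "\<dots> = (\<Sum>k\<le>n. smult (of_nat ((n + k) choose (2 * k)) * catalan k) ((\<q> - 1) ^ (n - k)))"
  proof (intro sum.cong refl)
    fix k assume "k \<in> {..n}"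
    then have "(n + k) choose (n - k) = (n + k) choose (2 * k)"
      using binomial_symmetric[of "n - k" "n + k"] by (simp add: mult_2)
    then show "smult (of_nat ((n + k) choose (n - k)) * catalan k) ((\<q> - 1) ^ (n - k)) =
      smult (of_nat ((n + k) choose (2 * k)) * catalan k) ((\<q> - 1) ^ (n - k))" by simp
  qed
  finally show ?thesis .
qed

section \<open>The first identity and the assembly of all three\<close>

text \<open>By \<open>narayana_shift\<close>, the \<open>k\<close>-th product is a combination of
  powers of 1 - q with exponents \<open>n - j\<close> independent of \<open>k\<close>. After
  swapping, \<open>ballot_inverse\<close> keeps only \<open>j = n\<close>, the constant
  term.\<close>

lemma sum_ballot_narayana: "(\<Sum>k\<le>n. smult (ballot n k) (narayana k * (1 - \<q>) ^ (n - k))) = [:catalan n:]"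
proof -
  have N: "narayana k * (1 - \<q>) ^ (n - k) =
      (\<Sum>j\<le>n. smult ((-1) ^ (k + j) * of_nat ((k + j) choose (2 * j)) * catalan j) ((1 - \<q>) ^ (n - j)))"
    if "k \<le> n" for k
  proof -
    have p: "(\<q> - 1) ^ (k - j) * (1 - \<q>) ^ (n - k) = smult ((-1) ^ (k + j)) ((1 - \<q>) ^ (n - j))"
      if "j \<le> k" for j
    proof -
      have "(\<q> - 1) ^ (k - j) = smult ((-1) ^ (k - j)) ((1 - \<q>) ^ (k - j))"
        by (simp flip: smult_power)
      also have "(-1) ^ (k - j) = ((-1) ^ (k + j) :: rat)"
        using that by (intro minus_one_power_iff[THEN trans]) (auto simp: minus_one_power_iff)
      finally show ?thesis using that \<open>k \<le> n\<close> by (simp flip: power_add)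
    qed
    have "narayana k * (1 - \<q>) ^ (n - k) =
      (\<Sum>j\<le>k. smult ((-1) ^ (k + j) * of_nat ((k + j) choose (2 * j)) * catalan j) ((1 - \<q>) ^ (n - j)))"
      unfolding narayana_shift[of k] sum_distrib_right
      by (intro sum.cong refl) (simp add: p, simp add: mult_ac)
    \<comment> \<open>For \<open>j > k\<close> the binomial is 0 because
      \<open>k + j < 2 * j\<close>; the range no longer depends on \<open>k\<close>.\<close>
    also have "\<dots> = (\<Sum>j\<le>n. smult ((-1) ^ (k + j) * of_nat ((k + j) choose (2 * j)) * catalan j) ((1 - \<q>) ^ (n - j)))"
      by (rule sum.mono_neutral_left) (use that in auto)
    finally show ?thesis .
  qed
  have "(\<Sum>k\<le>n. smult (ballot n k) (narayana k * (1 - \<q>) ^ (n - k))) =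
      (\<Sum>k\<le>n. \<Sum>j\<le>n. smult (ballot n k * ((-1) ^ (k + j) * of_nat ((k + j) choose (2 * j))) * catalan j) ((1 - \<q>) ^ (n - j)))"
    by (intro sum.cong refl) (simp add: N smult_sum_right mult_ac)
  also have "\<dots> = (\<Sum>j\<le>n. smult ((\<Sum>k\<le>n. ballot n k * ((-1) ^ (k + j) * of_nat ((k + j) choose (2 * j)))) * catalan j)
      ((1 - \<q>) ^ (n - j)))"
    by (subst sum.swap) (simp add: smult_sum sum_distrib_right)
  also have "\<dots> = (\<Sum>j\<le>n. if j = n then [:catalan n:] else 0)"
    unfolding ballot_inverse by (intro sum.cong) auto
  finally show ?thesis by simp
qed

theorem theorem1p1:
  fixes n :: nat
  shows "[:catalan n:] =
      (\<Sum>k = 0..n. smult (of_nat (2 * k + 1) / of_nat (2 * n + 1) * of_nat ((2 * n + 1) choose (n - k)))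
                     (narayana k * (1 - \<q>) ^ (n - k)))
    \<and> smult (catalan_half n) (\<q> ^ (n div 2 + 1)) =
      (\<Sum>k = 0..n. (-1) ^ (n - k) * of_nat (n choose k) * narayana (k + 1) * (1 + \<q>) ^ (n - k))
    \<and> smult (catalan (n + 1)) (\<q> ^ (n + 2)) =
      (\<Sum>k = 0..n. (-1) ^ (n - k) * of_nat (n choose k) * (narayana (k + 1) \<circ>\<^sub>p \<q>\<^sup>2)
                     * (1 - \<q>) ^ (2 * (n - k)))"
proof (intro conjI)
  show "[:catalan n:] =
      (\<Sum>k = 0..n. smult (of_nat (2 * k + 1) / of_nat (2 * n + 1) * of_nat ((2 * n + 1) choose (n - k)))
                     (narayana k * (1 - \<q>) ^ (n - k)))"
    unfolding sum_ballot_narayana[symmetric] atLeast0AtMost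
    by (intro sum.cong refl arg_cong2[of _ _ _ _ smult] ballot_altdef[symmetric]) simp
  \<comment> \<open>The opposite parameters cancel, leaving the identity transform.\<close>
  have "smult (catalan_half n) (\<q> ^ (n div 2 + 1)) =
      binom_trans (- (1 + \<q>)) (binom_trans (1 + \<q>) aerated_catalan) n"
    unfolding binom_trans_binom_trans by (simp only: left_minus binom_trans_0 aerated_catalan_def)
  also have "\<dots> = binom_trans (- (1 + \<q>)) (\<lambda>k. narayana (k + 1)) n"
    by (simp add: narayana_gamma binom_trans_def)
  also have "\<dots> =
      (\<Sum>k = 0..n. (-1) ^ (n - k) * of_nat (n choose k) * narayana (k + 1) * (1 + \<q>) ^ (n - k))"
    unfolding binom_trans_def atLeast0AtMost power_minus[of "1 + \<q>"]
    by (intro sum.cong refl) (simp only: mult_ac)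
  finally show "smult (catalan_half n) (\<q> ^ (n div 2 + 1)) =
      (\<Sum>k = 0..n. (-1) ^ (n - k) * of_nat (n choose k) * narayana (k + 1) * (1 + \<q>) ^ (n - k))" .
  \<comment> \<open>Read as a power of the square of 1 - q, the last factor combines with the sign
    into a power of the transform's parameter.\<close>
  show "smult (catalan (n + 1)) (\<q> ^ (n + 2)) =
      (\<Sum>k = 0..n. (-1) ^ (n - k) * of_nat (n choose k) * (narayana (k + 1) \<circ>\<^sub>p \<q>\<^sup>2)
                     * (1 - \<q>) ^ (2 * (n - k)))"
    unfolding Suc_eq_plus1[symmetric] narayana_square_transform[symmetric]
    unfolding binom_trans_def atLeast0AtMost power_minus[of "(1 - \<q>)\<^sup>2"] power_mult
    by (intro sum.cong refl) (simp only: mult_ac)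
qed

end
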